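(* Let $R$ be a ring with involution $*$, let $a\in R$ be pseudo core invertible, let $b\in R$, $f=a+b$, and let $s$ be a positive integer. If $1+a^{(D)}b$ is invertible, then the following statements are equivalent: (1) $(1-aa^{(D)})baa^{(D)}=0$ and $(1-aa^{(D)})(a+b)^s(1-aa^{(D)})=0$; (2) $f$ is pseudo core invertible and $f^{(D)}=(1+a^{(D)}b)^{-1}a^{(D)}$ with ${\rm i}(f)\leqslant s$; (3) $1+a^Db$ is invertible and $(1+a^Db)^{-1}a^D$ is a minimal weak Drazin inverse of $f$, with ${\rm i}(f)\leqslant s$; (4) for arbitrary $y\in T_l(a)$, $(1+a^{(D)}b)^{-1}y$ is a minimal weak Drazin inverse of $f$, with ${\rm i}(f)\leqslant s$. In this case, $T_l(f)=\alpha T_l(a)$, where $\alpha=(1+a^{(D)}b)^{-1}$.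
   Context: Rings are associative with identity $1$; an involution is an additive map $*$ on $R$ with $(xy)^*=y^*x^*$ and $(x^* )^*=x$. An element $a\in R$ is Drazin invertible if there are $x\in R$ and a positive integer $k$ with $xa^{k+1}=a^k$, $ax^2=x$, $xa=ax$; then $x$ is unique and denoted $a^D$, and the smallest such positive integer $k$ is the Drazin index ${\rm i}(a)$. An element $a\in R$ is pseudo core invertible if there are $x\in R$ and a positive integer $k$ with $xa^{k+1}=a^k$, $ax^2=x$, $(ax)^*=ax$; then $x$ is unique and denoted $a^{(D)}$. Every pseudo core invertible element is Drazin invertible, and the smallest positive integer $k$ in the latter definition equals the Drazin index ${\rm i}(a)$. For a Drazin invertible $a$, $T_l(a)=\{x\in R:\ xa^{k+1}=a^k \text{ for some positive integer } k,\ ax^2=x\}$; its elements are the minimal weak Drazin inverses of $a$. If some $x\in R$ and positive integer $k$ satisfy $xa^{k+1}=a^k$ and $ax^2=x$, then $a$ is automatically Drazin invertible. For $c\in R$ and $X\subseteq R$, $cX=\{cx:x\in X\}$. *)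

theory Defs
  imports Main
begin

text \<open>
  Rings are associative with identity. The class \<open>ring_1\<close> would demand \<open>0 \<noteq> 1\<close>;
  \<open>ring + monoid_mult\<close> also admits the zero ring.
\<close>

class involution_ring = ring + monoid_mult +
  fixes star :: "'a \<Rightarrow> 'a"
  assumes star_add: "star (x + y) = star x + star y"
    and star_mult: "star (x * y) = star y * star x"
    and star_star: "star (star x) = x"

definition invertible_elem :: "'a::monoid_mult \<Rightarrow> bool" where
  "invertible_elem u \<longleftrightarrow> (\<exists>v. u * v = 1 \<and> v * u = 1)"

definition inverse_elem :: "'a::monoid_mult \<Rightarrow> 'a" where
  "inverse_elem u = (THE v. u * v = 1 \<and> v * u = 1)"

definition is_drazin_inverse :: "'a::monoid_mult \<Rightarrow> 'a \<Rightarrow> bool" where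
  "is_drazin_inverse a x \<longleftrightarrow>
    (\<exists>k>0. x * a ^ (k + 1) = a ^ k \<and> a * x ^ 2 = x \<and> x * a = a * x)"

definition drazin_invertible :: "'a::monoid_mult \<Rightarrow> bool" where
  "drazin_invertible a \<longleftrightarrow> (\<exists>x. is_drazin_inverse a x)"

definition drazin_inverse :: "'a::monoid_mult \<Rightarrow> 'a" where
  "drazin_inverse a = (THE x. is_drazin_inverse a x)"

text \<open>
  The index is the least \<^emph>\<open>positive\<close> exponent, so it is 1 (not 0) for invertible elements.
  It is meaningful only for Drazin invertible elements.
\<close>

definition drazin_index :: "'a::monoid_mult \<Rightarrow> nat" where
  "drazin_index a =
    (LEAST k. k > 0 \<and> (\<exists>x. x * a ^ (k + 1) = a ^ k \<and> a * x ^ 2 = x \<and> x * a = a * x))"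

definition is_pseudo_core_inverse :: "'a::involution_ring \<Rightarrow> 'a \<Rightarrow> bool" where
  "is_pseudo_core_inverse a x \<longleftrightarrow>
    (\<exists>k>0. x * a ^ (k + 1) = a ^ k \<and> a * x ^ 2 = x \<and> star (a * x) = a * x)"

definition pseudo_core_invertible :: "'a::involution_ring \<Rightarrow> bool" where
  "pseudo_core_invertible a \<longleftrightarrow> (\<exists>x. is_pseudo_core_inverse a x)"

definition pseudo_core_inverse :: "'a::involution_ring \<Rightarrow> 'a" where
  "pseudo_core_inverse a = (THE x. is_pseudo_core_inverse a x)"

text \<open>
  The set of minimal weak Drazin inverses of \<open>a\<close>. Drazin invertibility of \<open>a\<close> is not part of
  the definition: it holds as soon as the set is nonempty, see
  \<open>drazin_invertible_if_min_weak\<close> below.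
\<close>

definition min_weak_drazin_inverses :: "'a::monoid_mult \<Rightarrow> 'a set" where
  "min_weak_drazin_inverses a =
    {x. \<exists>k>0. x * a ^ (k + 1) = a ^ k \<and> a * x ^ 2 = x}"


text \<open>
  Uniqueness justifies the definite descriptions above; the last two lemmas show that
  \<open>drazin_index\<close> and \<open>drazin_inverse\<close> are only applied to Drazin invertible elements when they
  occur together with a pseudo core inverse or a minimal weak Drazin inverse.
\<close>

lemma inverse_elem_unique:
  fixes u :: "'a::monoid_mult"
  assumes "u * v = 1" "w * u = 1"
  shows "v = w"
  by (metis assms mult.assoc mult.left_neutral mult.right_neutral)

lemma inverse_elem_eqI:
  fixes u :: "'a::monoid_mult"
  assumes "u * v = 1" "v * u = 1"
  shows "inverse_elem u = v"
  unfolding inverse_elem_def using assms inverse_elem_unique by (intro the_equality) auto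

lemma min_weak_power_left:
  fixes a x :: "'a::monoid_mult"
  assumes "x * a ^ (k + 1) = a ^ k"
  shows "x ^ n * a ^ (k + n) = a ^ k"
proof (induction n)
  case (Suc n)
  have "a ^ (k + Suc n) = a ^ (k + 1) * a ^ n" by (simp flip: power_add power_Suc)
  then have "x ^ Suc n * a ^ (k + Suc n) = x ^ n * (x * a ^ (k + 1) * a ^ n)"
    by (simp only: power_Suc2 mult.assoc)
  also have "\<dots> = x ^ n * a ^ (k + n)"
    unfolding assms by (simp add: power_add)
  finally show ?case using Suc by simp
qed simp

lemma min_weak_power_right:
  fixes a x :: "'a::monoid_mult"
  assumes "a * x ^ 2 = x"
  shows "a ^ n * x ^ (n + 1) = x"
proof (induction n)
  case (Suc n)
  have "a ^ Suc n * x ^ (Suc n + 1) = a ^ n * (a * x ^ 2 * x ^ n)"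
    by (simp add: mult.assoc power_Suc2 del: power_Suc flip: power_add)
  also have "\<dots> = a ^ n * x ^ (n + 1)"
    unfolding assms by simp
  finally show ?case using Suc by simp
qed simp

lemma min_weak_absorb:
  fixes a x y :: "'a::monoid_mult"
  assumes x: "x * a ^ (k + 1) = a ^ k" and y: "a * y ^ 2 = y"
  shows "x * a * y = y"
proof -
  have "x * a * y = x * a * (a ^ k * y ^ (k + 1))"
    by (simp only: min_weak_power_right[OF y])
  also have "\<dots> = x * a ^ (k + 1) * y ^ (k + 1)" by (simp add: mult.assoc)
  also have "\<dots> = y" by (simp only: x min_weak_power_right[OF y])
  finally show ?thesis .
qed

lemma drazin_inverse_unique:
  fixes a x y :: "'a::monoid_mult"
  assumes "is_drazin_inverse a x" "is_drazin_inverse a y"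
  shows "x = y"
proof -
  obtain k l where
    x: "x * a ^ (k + 1) = a ^ k" "a * x ^ 2 = x" "x * a = a * x" and
    y: "y * a ^ (l + 1) = a ^ l" "a * y ^ 2 = y" "y * a = a * y"
    using assms unfolding is_drazin_inverse_def by blast
  have 1: "x * a * y = y" "y * a * x = x" "x * a * x = x" "y * a * y = y"
    using min_weak_absorb x y by blast+
  have xp: "x = x ^ (n + 1) * a ^ n" for n
  proof (induction n)
    case (Suc n)
    have "x ^ (Suc n + 1) * a ^ Suc n = x ^ n * (x * x * a) * a ^ n"
      by (simp only: power_Suc2 power_Suc add_Suc add_0_right Suc_eq_plus1[symmetric] mult.assoc)
         (simp add: mult.assoc power_commutes)
    also have "x * x * a = x" by (metis 1(3) mult.assoc x(3))
    finally show ?case using Suc by (simp add: power_commutes)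
  qed simp
  have "x * a * y = x ^ (l + 1) * (a ^ (l + 1) * y)"
    by (subst xp[of l]) (simp only: mult.assoc power_add power_one_right)
  also have "a ^ (l + 1) * y = a ^ l"
  proof -
    have "y * a ^ n = a ^ n * y" for n
      by (induction n) (simp_all add: y(3) mult.assoc, metis mult.assoc y(3))
    from this[of "l + 1"] show ?thesis using y(1) by metis
  qed
  finally show ?thesis using 1(1) xp[of l] by simp
qed

lemma pseudo_core_inverse_unique:
  fixes a x y :: "'a::involution_ring"
  assumes "is_pseudo_core_inverse a x" "is_pseudo_core_inverse a y"
  shows "x = y"
proof -
  obtain k l where
    x: "x * a ^ (k + 1) = a ^ k" "a * x ^ 2 = x" "star (a * x) = a * x" and
    y: "y * a ^ (l + 1) = a ^ l" "a * y ^ 2 = y" "star (a * y) = a * y"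
    using assms unfolding is_pseudo_core_inverse_def by blast
  have 1: "x * a * y = y" "y * a * x = x" "x * a * x = x"
    using min_weak_absorb x y by blast+
  have xy: "a * x * (a * y) = a * y" and yx: "a * y * (a * x) = a * x"
    by (metis 1 mult.assoc)+
  have "a * x = a * y"
    by (metis xy yx x(3) y(3) star_mult)
  then show ?thesis by (metis 1 mult.assoc)
qed

lemma drazin_invertible_if_min_weak:
  fixes a x :: "'a::monoid_mult"
  assumes "x \<in> min_weak_drazin_inverses a"
  shows "drazin_invertible a"
proof -
  obtain k where k: "k > 0" and x: "x * a ^ (k + 1) = a ^ k" "a * x ^ 2 = x"
    using assms unfolding min_weak_drazin_inverses_def by blast
  obtain j where j: "k = Suc j" using k gr0_implies_Suc by blast
  define d where "d = x ^ (k + 1) * a ^ k"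
  have "x ^ (k + 1) = x ^ 2 * x ^ j"
    by (simp add: j flip: power_add)
  then have "a * x ^ (k + 1) = a * x ^ 2 * x ^ j" by (simp only: mult.assoc)
  then have ax: "a * x ^ (k + 1) = x ^ k" by (simp only: x(2)) (simp add: j)
  have ad: "a * d = x ^ k * a ^ k"
    unfolding d_def by (simp only: ax flip: mult.assoc)
  have "d * a = x ^ k * (x * a ^ (k + 1))"
    unfolding d_def by (simp add: mult.assoc power_Suc2 del: power_Suc)
  then have da: "d * a = a * d" by (simp only: x(1) ad)
  have "d * a ^ (k + 1) = x ^ (k + 1) * a ^ (k + (k + 1))"
    unfolding d_def by (simp only: mult.assoc power_add)
  then have dk: "d * a ^ (k + 1) = a ^ k"
    by (simp only: min_weak_power_left[OF x(1)])
  have "a * d ^ 2 = x ^ k * (a ^ k * x ^ (k + 1)) * a ^ k"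
    by (simp only: power2_eq_square mult.assoc[symmetric] ad) (simp only: d_def mult.assoc)
  also have "\<dots> = d"
    by (simp only: min_weak_power_right[OF x(2)]) (simp add: d_def power_commutes)
  finally show ?thesis
    unfolding drazin_invertible_def is_drazin_inverse_def using k dk da by blast
qed

lemma drazin_invertible_if_pseudo_core_invertible:
  "pseudo_core_invertible a \<Longrightarrow> drazin_invertible a"
  using drazin_invertible_if_min_weak
  unfolding pseudo_core_invertible_def is_pseudo_core_inverse_def min_weak_drazin_inverses_def
  by blast

end

theory Submission
  imports Defs
begin

text \<open>
  A minimal weak Drazin inverse \<open>x\<close> of \<open>a\<close> is best read off the Peirce decomposition for the
  idempotent \<open>p = a x\<close>. Relative to \<open>p\<close> and \<open>1 - p\<close> the element \<open>a\<close> is block upper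
  triangular, its upper left block \<open>a p\<close> is invertible in the corner ring \<open>p R p\<close> with inverse
  \<open>x p\<close>, and its lower right block is nilpotent; the index of \<open>a\<close> is the least positive
  \<open>k\<close> with \<open>p a\<^sup>k = a\<^sup>k\<close> (lemmas \<open>min_weak_inverse_on_corner\<close> and
  \<open>drazin_index_le_iff\<close>). Another minimal weak Drazin inverse \<open>y\<close> gives an idempotent
  \<open>q = a y\<close> with the same right ideal: \<open>p q = q\<close> and \<open>q p = p\<close>.

  Condition (1) says that \<open>f = a + b\<close> has the same shape: it is block upper triangular for
  \<open>p\<close> and the \<open>s\<close>-th power of its lower right block vanishes. The remaining ingredient, an
  invertible upper left block, is what the invertibility of \<open>1 + x b\<close> provides, since
  \<open>(1 + x b) p = x f p\<close>; the inverse of that block is \<open>\<alpha> x\<close> with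
  \<open>\<alpha> = (1 + x b)\<inverse>\<close>. So (1) makes \<open>\<alpha> x\<close>, and likewise every \<open>\<alpha> y\<close>, a minimal weak
  Drazin inverse of \<open>f\<close> belonging to the same idempotent, \<open>f (\<alpha> y) = a y\<close>. If \<open>a x\<close> is
  hermitian, then so is \<open>f (\<alpha> x)\<close>, and pseudo core inverses correspond.

  Conversely, \<open>p f (\<alpha> y) = q\<close> always holds, as a rewriting of \<open>(1 + x b) \<alpha> y = y\<close>. If
  \<open>z = \<alpha> y\<close> is a minimal weak Drazin inverse of \<open>f\<close>, then \<open>f z = z f (f z)\<close> lies in
  \<open>p R\<close>, so that \<open>f z = q\<close>, and the block form of \<open>f\<close> for its own idempotent \<open>f z\<close> is
  (1). Thus each of (2), (3), (4) is equivalent to (1) by the single lemma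
  \<open>perturbed_min_weak_iff\<close>. For (3) it is applied with the Drazin inverse \<open>d\<close> in place of
  both \<open>x\<close> and \<open>y\<close>; the invertibility of \<open>1 + d b\<close> under (1) comes from
  \<open>inverse_change_min_weak\<close>, which also shows \<open>(1 + d b)\<inverse> d = \<alpha> d\<close>.
\<close>

section \<open>Minimal weak Drazin inverses and their idempotents\<close>

lemma min_weakE:
  fixes a x :: "'a::monoid_mult"
  assumes "x \<in> min_weak_drazin_inverses a"
  obtains k where "k > 0" "x * a ^ (k + 1) = a ^ k" "a * x ^ 2 = x"
  using assms unfolding min_weak_drazin_inverses_def by auto

text \<open>
  The idempotents of two minimal weak Drazin inverses generate the same right ideal, because
  both generate \<open>a\<^sup>k R\<close> for large \<open>k\<close>.
\<close>

lemma min_weak_idempotent_fixes: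
  fixes a x y :: "'a::monoid_mult"
  assumes "x \<in> min_weak_drazin_inverses a" "y \<in> min_weak_drazin_inverses a"
  shows "x * a * y = y" "a * x * y = y" "a * x * (a * y) = a * y"
proof -
  obtain k where x: "x * a ^ (k + 1) = a ^ k" using assms(1) by (rule min_weakE)
  have y: "a * y ^ 2 = y" using assms(2) by (rule min_weakE)
  show 1: "x * a * y = y" by (rule min_weak_absorb[OF x y])
  show 3: "a * x * (a * y) = a * y" by (metis 1 mult.assoc)
  show "a * x * y = y" by (metis 3 y mult.assoc power2_eq_square)
qed

text \<open>
  Since \<open>a y = a\<^sup>k (a y\<^sup>k\<^sup>+\<^sup>1)\<close> for all \<open>k\<close>, a left factor \<open>x a\<close> is absorbed as soon as
  \<open>x a\<^sup>k\<^sup>+\<^sup>1 = a\<^sup>k\<close>. For \<open>y = x\<close> this makes \<open>x\<close> a left inverse of \<open>a\<close> on the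
  corner of \<open>a x\<close>.
\<close>

lemma min_weak_inverse_on_corner:
  fixes a x y :: "'a::monoid_mult"
  assumes "x \<in> min_weak_drazin_inverses a" "y \<in> min_weak_drazin_inverses a"
  shows "x * a * (a * y) = a * y"
proof -
  obtain k where x: "x * a ^ (k + 1) = a ^ k" using assms(1) by (rule min_weakE)
  have y: "a * y ^ 2 = y" using assms(2) by (rule min_weakE)
  have eq: "a * y = a ^ k * (a * y ^ (k + 1))"
    using min_weak_power_right[OF y, of k] by (metis mult.assoc power_commutes)
  have "x * a * (a * y) = x * a ^ (k + 1) * (a * y ^ (k + 1))"
    by (subst eq) (simp add: mult.assoc)
  also have "\<dots> = a * y"
    unfolding x using eq by simp
  finally show ?thesis .
qed

text \<open>
  Multiplying the corner identity by \<open>a\<close> from the left gives the block triangularity of \<open>a\<close>.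
\<close>

lemma min_weak_idempotent_invariant:
  fixes a x :: "'a::monoid_mult"
  assumes "x \<in> min_weak_drazin_inverses a"
  shows "a * x * (a * (a * x)) = a * (a * x)"
  using min_weak_inverse_on_corner[OF assms assms] by (simp add: mult.assoc)

lemma min_weak_exponent_iff:
  fixes a x :: "'a::monoid_mult"
  assumes "x \<in> min_weak_drazin_inverses a"
  shows "x * a ^ (n + 1) = a ^ n \<longleftrightarrow> a * x * a ^ n = a ^ n"
proof
  assume x: "x * a ^ (n + 1) = a ^ n"
  have "a * x * a ^ n = a * x * x * a ^ (n + 1)" by (simp only: x mult.assoc)
  also have "a * x * x = x" by (rule min_weak_idempotent_fixes[OF assms assms])
  finally show "a * x * a ^ n = a ^ n" by (simp only: x)
next
  assume p: "a * x * a ^ n = a ^ n"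
  have "x * a ^ (n + 1) = x * a * (a * x * a ^ n)" by (simp only: p) (simp add: mult.assoc)
  also have "\<dots> = a * x * a ^ n"
    using min_weak_inverse_on_corner[OF assms assms] by (metis mult.assoc)
  finally show "x * a ^ (n + 1) = a ^ n" by (simp only: p)
qed

text \<open>
  Every minimal weak Drazin inverse detects the index. One direction transfers the exponent from
  the Drazin inverse to \<open>x\<close>; the other turns \<open>x\<close> into a Drazin inverse with the same exponent.
\<close>

lemma drazin_index_le_iff:
  fixes a x :: "'a::monoid_mult"
  assumes x: "x \<in> min_weak_drazin_inverses a" and "n > 0"
  shows "drazin_index a \<le> n \<longleftrightarrow> a * x * a ^ n = a ^ n"
proof
  let ?D = "\<lambda>k. k > 0 \<and> (\<exists>d. d * a ^ (k + 1) = a ^ k \<and> a * d ^ 2 = d \<and> d * a = a * d)"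
  assume le: "drazin_index a \<le> n"
  have "\<exists>k. ?D k"
    using drazin_invertible_if_min_weak[OF x]
    unfolding drazin_invertible_def is_drazin_inverse_def by blast
  then have "?D (drazin_index a)" unfolding drazin_index_def by (rule LeastI_ex)
  then obtain d where d: "d * a ^ (drazin_index a + 1) = a ^ drazin_index a" "a * d ^ 2 = d"
    and pos: "drazin_index a > 0" by blast
  have "d \<in> min_weak_drazin_inverses a"
    using d pos unfolding min_weak_drazin_inverses_def by blast
  then have "a * x * d = d" by (rule min_weak_idempotent_fixes[OF x])
  then have "a * x * a ^ drazin_index a = a ^ drazin_index a"
    by (metis d(1) mult.assoc)
  moreover have "a ^ n = a ^ drazin_index a * a ^ (n - drazin_index a)"
    using le by (simp flip: power_add)
  ultimately show "a * x * a ^ n = a ^ n" by (simp flip: mult.assoc)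
next
  assume "a * x * a ^ n = a ^ n"
  then have xn: "x * a ^ (n + 1) = a ^ n" by (simp only: min_weak_exponent_iff[OF x])
  have ax: "a * x ^ 2 = x" using x by (rule min_weakE)
  \<comment> \<open>The Drazin inverse is \<open>x\<^sup>n\<^sup>+\<^sup>1 a\<^sup>n\<close>: multiplying by \<open>a\<close> on either side
    gives \<open>x\<^sup>n a\<^sup>n\<close>.\<close>
  define d where "d = x ^ (n + 1) * a ^ n"
  have "a * x ^ (n + 1) = x ^ n"
  proof -
    obtain j where "n = Suc j" using \<open>n > 0\<close> gr0_implies_Suc by blast
    then show ?thesis using ax by (simp add: power2_eq_square flip: mult.assoc)
  qed
  then have ad: "a * d = x ^ n * a ^ n" unfolding d_def by (simp flip: mult.assoc)
  have "d * a = x ^ n * (x * a ^ (n + 1))"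
    unfolding d_def by (simp add: mult.assoc power_Suc2 del: power_Suc)
  then have da: "d * a = a * d" by (simp only: xn ad)
  have "d * a ^ (n + 1) = x ^ (n + 1) * a ^ (n + (n + 1))"
    unfolding d_def by (simp only: mult.assoc power_add)
  then have dn: "d * a ^ (n + 1) = a ^ n" by (simp only: min_weak_power_left[OF xn])
  have "a * d ^ 2 = x ^ n * (a ^ n * x ^ (n + 1)) * a ^ n"
    by (simp only: power2_eq_square mult.assoc[symmetric] ad) (simp only: d_def mult.assoc)
  also have "\<dots> = d"
    by (simp only: min_weak_power_right[OF ax]) (simp add: d_def power_commutes)
  finally show "drazin_index a \<le> n"
    unfolding drazin_index_def using \<open>n > 0\<close> dn da by (intro Least_le) blast
qed

text \<open>
  The converse of the block picture: an inverse of \<open>f\<close> on the corner of \<open>q\<close> is a minimal weak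
  Drazin inverse once some power of \<open>f\<close> maps into the range of \<open>q\<close>.
\<close>

lemma min_weakI:
  fixes f z q :: "'a::monoid_mult"
  assumes "f * z = q" "q * z = z" "z * f * q = q" "q * f ^ n = f ^ n" "n > 0"
  shows "z \<in> min_weak_drazin_inverses f"
proof -
  have "f * z ^ 2 = z" using assms by (metis mult.assoc power2_eq_square)
  moreover have "z * f ^ (n + 1) = f ^ n"
    by (metis (no_types, lifting) assms(3,4) mult.assoc power_Suc Suc_eq_plus1)
  ultimately show ?thesis using \<open>n > 0\<close> unfolding min_weak_drazin_inverses_def by blast
qed

section \<open>Perturbations with a common idempotent range\<close>

text \<open>
  For an idempotent \<open>p\<close>, the first equation says that the lower left Peirce block
  \<open>(1 - p) f p\<close> vanishes. Given that, the second one says that the lower right block of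
  \<open>f ^ s\<close>, which is the \<open>s\<close>-th power of the lower right block of \<open>f\<close>, vanishes.
\<close>

definition block_triangular :: "'a::monoid_mult \<Rightarrow> 'a \<Rightarrow> nat \<Rightarrow> bool" where
  "block_triangular f p s \<longleftrightarrow> p * f * p = f * p \<and> p * f ^ s = f ^ s"

text \<open>
  The condition depends only on the right ideal generated by \<open>p\<close>. Hence it may be checked with
  the idempotent of any minimal weak Drazin inverse of \<open>a\<close>.
\<close>

lemma block_triangular_cong:
  fixes f p q :: "'a::monoid_mult"
  assumes "p * q = q" "q * p = p" "block_triangular f p s"
  shows "block_triangular f q s"
proof -
  have fp: "p * f * p = f * p" and fs: "p * f ^ s = f ^ s"
    using assms(3) unfolding block_triangular_def by blast+
  have "p * (f * q) = f * q"
    using fp arg_cong[OF assms(1), of "\<lambda>t. f * t"] by (metis mult.assoc)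
  then have "q * f * q = f * q" using assms(2) by (metis mult.assoc)
  moreover have "q * f ^ s = f ^ s" using fs assms(2) by (metis mult.assoc)
  ultimately show ?thesis unfolding block_triangular_def by blast
qed

lemma invariant_power:
  fixes f p :: "'a::monoid_mult"
  assumes "p * p = p" "p * f * p = f * p"
  shows "p * f ^ n * p = f ^ n * p"
proof (induction n)
  case (Suc n)
  have "p * f ^ Suc n * p = p * f * (f ^ n * p)" by (simp add: mult.assoc)
  also have "\<dots> = p * f * p * (f ^ n * p)" by (subst Suc[symmetric]) (simp only: mult.assoc)
  also have "\<dots> = f * (p * f ^ n * p)" unfolding assms(2) by (simp only: mult.assoc)
  also have "\<dots> = f ^ Suc n * p" by (simp only: Suc) (simp add: mult.assoc)
  finally show ?case .
qed (use assms in simp)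

text \<open>
  As \<open>a\<close> is block triangular, \<open>a + b\<close> is so exactly when \<open>b\<close> is. In that case
  \<open>(1 - p) (a + b)\<^sup>s p = 0\<close> as well, and the right factor \<open>1 - p\<close> in the power condition
  can be dropped.
\<close>

lemma block_triangular_iff:
  fixes a b x :: "'a::{ring,monoid_mult}"
  assumes x: "x \<in> min_weak_drazin_inverses a"
  defines "p \<equiv> a * x"
  shows "block_triangular (a + b) p s \<longleftrightarrow>
    (1 - p) * b * p = 0 \<and> (1 - p) * (a + b) ^ s * (1 - p) = 0"
proof -
  have pp: "p * p = p" unfolding p_def by (rule min_weak_idempotent_fixes[OF x x])
  have pa: "p * a * p = a * p"
    unfolding p_def using min_weak_idempotent_invariant[OF x] by (simp add: mult.assoc)
  have 1: "(1 - p) * b * p = 0 \<longleftrightarrow> p * (a + b) * p = (a + b) * p"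
  proof -
    have "(1 - p) * b * p = b * p - p * b * p" by (simp add: left_diff_distrib)
    also have "\<dots> = (a + b) * p - p * (a + b) * p"
      by (simp add: distrib_left distrib_right pa)
    finally show ?thesis by auto
  qed
  have "(1 - p) * (a + b) ^ s * (1 - p) = 0 \<longleftrightarrow> p * (a + b) ^ s = (a + b) ^ s"
    if "p * (a + b) * p = (a + b) * p"
  proof -
    have "(1 - p) * (a + b) ^ s * (1 - p) = (a + b) ^ s - p * (a + b) ^ s"
      using invariant_power[OF pp that, of s]
      by (simp add: left_diff_distrib right_diff_distrib)
    then show ?thesis by auto
  qed
  with 1 show ?thesis unfolding block_triangular_def by blast
qed

context
  fixes a b x y \<alpha> :: "'a::{ring,monoid_mult}"
  assumes x: "x \<in> min_weak_drazin_inverses a"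
    and y: "y \<in> min_weak_drazin_inverses a"
    and right: "(1 + x * b) * \<alpha> = 1" and left: "\<alpha> * (1 + x * b) = 1"
begin

lemma perturbed_equation: "\<alpha> * y + x * b * (\<alpha> * y) = y"
proof -
  have "\<alpha> * y + x * b * (\<alpha> * y) = (1 + x * b) * \<alpha> * y" by (simp add: algebra_simps)
  then show ?thesis by (simp add: right)
qed

text \<open>
  Solving \<open>perturbed_equation\<close> for \<open>\<alpha> y\<close> expresses it as an element of \<open>y R + x R\<close>,
  and both \<open>x\<close> and \<open>y\<close> lie in the range of \<open>a x\<close>.
\<close>

lemma perturbed_in_range: "a * x * (\<alpha> * y) = \<alpha> * y"
proof -
  have "a * x * (\<alpha> * y) = a * x * (y - x * b * (\<alpha> * y))"
    using perturbed_equation by (metis add_diff_cancel_right')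
  also have "\<dots> = a * x * y - a * x * x * b * (\<alpha> * y)" by (simp add: algebra_simps)
  also have "\<dots> = y - x * b * (\<alpha> * y)"
    using min_weak_idempotent_fixes[OF x] x y by simp
  also have "\<dots> = \<alpha> * y" using perturbed_equation by (metis add_diff_cancel_right')
  finally show ?thesis .
qed

text \<open>
  On the range of \<open>a x\<close> the factor \<open>x a\<close> is the identity, so \<open>x (a + b) \<alpha> y\<close> is
  \<open>(1 + x b) \<alpha> y = y\<close>. This ties \<open>a + b\<close> and \<open>\<alpha> y\<close> to the old idempotent \<open>a y\<close>
  before anything is known about the blocks of \<open>b\<close>.
\<close>

lemma perturbed_compression: "a * x * ((a + b) * (\<alpha> * y)) = a * y"
proof -
  have "x * a * (\<alpha> * y) = \<alpha> * y"
    using perturbed_in_range min_weak_inverse_on_corner[OF x x] by (metis mult.assoc)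
  then have "x * ((a + b) * (\<alpha> * y)) = \<alpha> * y + x * b * (\<alpha> * y)"
    by (simp add: algebra_simps)
  then show ?thesis by (metis perturbed_equation mult.assoc)
qed

lemma perturbed_product:
  assumes "block_triangular (a + b) (a * x) s"
  shows "(a + b) * (\<alpha> * y) = a * y"
proof -
  have "(a + b) * (\<alpha> * y) = (a + b) * (a * x) * (\<alpha> * y)"
    by (simp only: perturbed_in_range mult.assoc[of "a + b" "a * x"])
  also have "\<dots> = a * x * (a + b) * (a * x) * (\<alpha> * y)"
    using assms unfolding block_triangular_def by simp
  also have "\<dots> = a * x * ((a + b) * (a * x * (\<alpha> * y)))" by (simp only: mult.assoc)
  also have "\<dots> = a * y" by (simp only: perturbed_in_range perturbed_compression)
  finally show ?thesis .
qed

lemma perturbed_min_weak: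
  assumes t: "block_triangular (a + b) (a * x) s" and s: "s > 0"
  shows "\<alpha> * y \<in> min_weak_drazin_inverses (a + b)"
proof (rule min_weakI)
  let ?p = "a * x" and ?q = "a * y" and ?f = "a + b"
  have pq: "?p * ?q = ?q" "?q * ?p = ?p"
    using min_weak_idempotent_fixes x y by blast+
  have tq: "block_triangular ?f ?q s" by (rule block_triangular_cong[OF pq t])
  show "?f * (\<alpha> * y) = ?q" by (rule perturbed_product[OF t])
  show "?q * (\<alpha> * y) = \<alpha> * y" by (metis perturbed_in_range pq(2) mult.assoc)
  show "?q * ?f ^ s = ?f ^ s" using tq unfolding block_triangular_def by blast
  have yq: "x * ?q = y" using min_weak_idempotent_fixes(1)[OF x y] by (simp add: mult.assoc)
  have "y * ?f * ?q = x * (?q * ?f * ?q)" by (metis yq mult.assoc)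
  also have "\<dots> = x * ?f * ?q"
    using tq unfolding block_triangular_def by (simp add: mult.assoc)
  also have "\<dots> = x * a * ?q + x * b * ?q" by (simp add: algebra_simps)
  also have "x * a * ?q = ?q" by (rule min_weak_inverse_on_corner[OF x y])
  also have "?q + x * b * ?q = (1 + x * b) * ?q" by (simp add: algebra_simps)
  finally have "\<alpha> * (y * ?f * ?q) = \<alpha> * (1 + x * b) * ?q" by (simp add: mult.assoc)
  then show "\<alpha> * y * ?f * ?q = ?q" by (simp add: left mult.assoc)
qed (rule s)

text \<open>
  For necessity, \<open>(a + b) z = z (a + b) (a + b) z\<close> puts the idempotent of \<open>z = \<alpha> y\<close> into the
  range of \<open>a x\<close>, where \<open>perturbed_compression\<close> identifies it as \<open>a y\<close>. So \<open>a + b\<close> is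
  block triangular for \<open>a y\<close>, hence for \<open>a x\<close>.
\<close>

lemma perturbed_min_weak_iff:
  assumes s: "s > 0"
  shows "\<alpha> * y \<in> min_weak_drazin_inverses (a + b) \<and> drazin_index (a + b) \<le> s \<longleftrightarrow>
    block_triangular (a + b) (a * x) s"
proof
  let ?p = "a * x" and ?q = "a * y" and ?f = "a + b" and ?z = "\<alpha> * y"
  assume "?z \<in> min_weak_drazin_inverses ?f \<and> drazin_index ?f \<le> s"
  then have z: "?z \<in> min_weak_drazin_inverses ?f" and i: "?f * ?z * ?f ^ s = ?f ^ s"
    using drazin_index_le_iff s by blast+
  have "?f * ?z = ?z * ?f * (?f * ?z)" by (rule min_weak_inverse_on_corner[OF z z, symmetric])
  then have "?f * ?z = ?p * (?f * ?z)" using perturbed_in_range by (metis mult.assoc)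
  then have fz: "?f * ?z = ?q" by (simp only: perturbed_compression)
  have "block_triangular ?f ?q s"
    unfolding block_triangular_def using i min_weak_idempotent_invariant[OF z] fz
    by (simp add: mult.assoc)
  then show "block_triangular ?f ?p s"
    using block_triangular_cong min_weak_idempotent_fixes(3) x y by blast
next
  assume t: "block_triangular (a + b) (a * x) s"
  have z: "\<alpha> * y \<in> min_weak_drazin_inverses (a + b)" by (rule perturbed_min_weak[OF t s])
  have "block_triangular (a + b) (a * y) s"
    using block_triangular_cong[OF _ _ t] min_weak_idempotent_fixes(3) x y by blast
  then have "drazin_index (a + b) \<le> s"
    by (simp only: drazin_index_le_iff[OF z s] perturbed_product[OF t] block_triangular_def)
  with z show "\<alpha> * y \<in> min_weak_drazin_inverses (a + b) \<and> drazin_index (a + b) \<le> s" by blast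
qed

text \<open>
  Replacing \<open>x\<close> by \<open>y\<close> does not affect \<open>x b w\<close> for \<open>w\<close> in the range of \<open>a x\<close>: by block
  triangularity \<open>b w\<close> stays in that range, where \<open>x\<close> and \<open>y\<close> act alike because both
  invert \<open>a\<close> there. Hence \<open>z = \<alpha> y\<close> satisfies \<open>(1 + y b) z = y = z (1 + b y)\<close>, and the
  standard passage from an inverse of \<open>1 + b y\<close> to one of \<open>1 + y b\<close> yields \<open>1 - z b\<close>.
\<close>

lemma inverse_change_min_weak:
  assumes "block_triangular (a + b) (a * x) s"
  shows "(1 + y * b) * (1 - \<alpha> * y * b) = 1" "(1 - \<alpha> * y * b) * (1 + y * b) = 1"
    "(1 - \<alpha> * y * b) * y = \<alpha> * y"
proof -
  let ?p = "a * x" and ?q = "a * y" and ?z = "\<alpha> * y"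
  have bp: "b * ?p = ?p * b * ?p"
    using assms min_weak_idempotent_invariant[OF x]
    unfolding block_triangular_def by (simp add: algebra_simps)
  have yp: "y * ?p = x * ?p"
    using min_weak_idempotent_fixes(1)[OF y x] min_weak_idempotent_fixes(1)[OF x x]
    by (simp add: mult.assoc)
  have swap: "y * b * w = x * b * w" if "?p * w = w" for w
    by (metis bp yp that mult.assoc)
  have zb: "?z + y * b * ?z = y"
    using perturbed_equation swap[OF perturbed_in_range] by simp
  have "y + y * b * y = (1 + x * b) * y"
    using swap[OF min_weak_idempotent_fixes(2)[OF x y]] by (simp add: algebra_simps)
  then have "\<alpha> * (y + y * b * y) = y" by (simp add: left flip: mult.assoc)
  then have bz: "?z + ?z * b * y = y" by (simp add: algebra_simps)
  have "(1 + y * b) * (1 - ?z * b) = 1 + y * b - (?z + y * b * ?z) * b"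
    by (simp add: algebra_simps)
  then show "(1 + y * b) * (1 - ?z * b) = 1" by (simp add: zb)
  have "(1 - ?z * b) * (1 + y * b) = 1 + y * b - (?z + ?z * b * y) * b"
    by (simp add: algebra_simps)
  then show "(1 - ?z * b) * (1 + y * b) = 1" by (simp add: bz)
  show "(1 - ?z * b) * y = ?z" using bz by (simp add: algebra_simps)
qed

end

text \<open>
  A minimal weak Drazin inverse is determined by its idempotent: \<open>w = z (f w)\<close> for any other
  one \<open>z\<close> of \<open>f\<close>. With \<open>z = \<alpha> x\<close> this exhibits \<open>w\<close> as \<open>\<alpha>\<close> times \<open>x (f w)\<close>,
  which is the minimal weak Drazin inverse of \<open>a\<close> with the same idempotent.
\<close>

lemma perturbed_min_weak_set:
  fixes a b x \<alpha> :: "'a::{ring,monoid_mult}"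
  assumes x: "x \<in> min_weak_drazin_inverses a"
    and inv: "(1 + x * b) * \<alpha> = 1" "\<alpha> * (1 + x * b) = 1"
    and t: "block_triangular (a + b) (a * x) s" and s: "s > 0"
  shows "min_weak_drazin_inverses (a + b) = (\<lambda>y. \<alpha> * y) ` min_weak_drazin_inverses a"
proof
  show "(\<lambda>y. \<alpha> * y) ` min_weak_drazin_inverses a \<subseteq> min_weak_drazin_inverses (a + b)"
    using perturbed_min_weak[OF x _ inv t s] by blast
  show "min_weak_drazin_inverses (a + b) \<subseteq> (\<lambda>y. \<alpha> * y) ` min_weak_drazin_inverses a"
  proof
    fix w assume w: "w \<in> min_weak_drazin_inverses (a + b)"
    let ?p = "a * x" and ?q = "(a + b) * w"
    have z: "\<alpha> * x \<in> min_weak_drazin_inverses (a + b)"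
      by (rule perturbed_min_weak[OF x x inv t s])
    have fz: "(a + b) * (\<alpha> * x) = ?p" by (rule perturbed_product[OF x x inv t])
    have pq: "?p * ?q = ?q" "?q * ?p = ?p"
      using min_weak_idempotent_fixes(3)[OF z w] min_weak_idempotent_fixes(3)[OF w z]
      by (simp_all only: fz)
    have px: "?p * x = x" by (rule min_weak_idempotent_fixes[OF x x])
    have xap: "x * a * ?p = ?p" by (rule min_weak_inverse_on_corner[OF x x])
    obtain k where k: "k > 0" "x * a ^ (k + 1) = a ^ k" using x by (rule min_weakE)
    have "x * ?q \<in> min_weak_drazin_inverses a"
    proof (rule min_weakI)
      show "a * (x * ?q) = ?q" using pq by (simp add: mult.assoc)
      show "?q * (x * ?q) = x * ?q" by (metis px pq(2) mult.assoc)
      show "?q * a ^ k = a ^ k"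
        using min_weak_exponent_iff[OF x, of k] k(2) pq(2) by (metis mult.assoc)
      have "?q * (a * ?p) = a * ?p"
        using min_weak_idempotent_invariant[OF x] pq(2) by (metis mult.assoc)
      then show "x * ?q * a * ?q = ?q" by (metis xap pq(1) mult.assoc)
    qed (rule k)
    moreover have "w = \<alpha> * (x * ?q)"
      using min_weak_idempotent_fixes(1)[OF z w] by (simp add: mult.assoc)
    ultimately show "w \<in> (\<lambda>y. \<alpha> * y) ` min_weak_drazin_inverses a" by blast
  qed
qed

section \<open>The equivalence\<close>

lemma is_pseudo_core_inverse_iff:
  "is_pseudo_core_inverse a x \<longleftrightarrow> x \<in> min_weak_drazin_inverses a \<and> star (a * x) = a * x"
  unfolding is_pseudo_core_inverse_def min_weak_drazin_inverses_def by auto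

lemma pseudo_core_inverse_eq_iff:
  "pseudo_core_invertible a \<and> pseudo_core_inverse a = x \<longleftrightarrow> is_pseudo_core_inverse a x"
proof -
  have "pseudo_core_inverse a = z" if "is_pseudo_core_inverse a z" for z
    unfolding pseudo_core_inverse_def
    using that pseudo_core_inverse_unique by (intro the_equality) blast+
  then show ?thesis unfolding pseudo_core_invertible_def by blast
qed

lemma drazin_inverse_min_weak:
  assumes "drazin_invertible a"
  shows "drazin_inverse a \<in> min_weak_drazin_inverses a"
proof -
  obtain d where d: "is_drazin_inverse a d" using assms unfolding drazin_invertible_def ..
  then have "drazin_inverse a = d"
    unfolding drazin_inverse_def
    using drazin_inverse_unique by (intro the_equality) blast+
  with d show ?thesis unfolding is_drazin_inverse_def min_weak_drazin_inverses_def by blast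
qed

lemma inverse_elem_cancel:
  assumes "invertible_elem u"
  shows "u * inverse_elem u = 1" "inverse_elem u * u = 1"
proof -
  obtain v where v: "u * v = 1" "v * u = 1" using assms unfolding invertible_elem_def by blast
  then show "u * inverse_elem u = 1" "inverse_elem u * u = 1"
    by (simp_all only: inverse_elem_eqI[OF v])
qed

theorem theorem4p1:
  fixes a b f \<alpha> :: "'a::involution_ring" and s :: nat
  defines "f \<equiv> a + b"
    and "\<alpha> \<equiv> inverse_elem (1 + pseudo_core_inverse a * b)"
  assumes "pseudo_core_invertible a"
    and "s > 0"
    and "invertible_elem (1 + pseudo_core_inverse a * b)"
  shows
    "let P1 = ((1 - a * pseudo_core_inverse a) * b * a * pseudo_core_inverse a = 0 \<and>
               (1 - a * pseudo_core_inverse a) * (a + b) ^ s * (1 - a * pseudo_core_inverse a) = 0);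
         P2 = (pseudo_core_invertible f \<and>
               pseudo_core_inverse f = \<alpha> * pseudo_core_inverse a \<and>
               drazin_index f \<le> s);
         P3 = (invertible_elem (1 + drazin_inverse a * b) \<and>
               inverse_elem (1 + drazin_inverse a * b) * drazin_inverse a
                 \<in> min_weak_drazin_inverses f \<and>
               drazin_index f \<le> s);
         P4 = (\<forall>y \<in> min_weak_drazin_inverses a.
                 \<alpha> * y \<in> min_weak_drazin_inverses f \<and> drazin_index f \<le> s)
     in (P1 \<longleftrightarrow> P2) \<and> (P2 \<longleftrightarrow> P3) \<and> (P3 \<longleftrightarrow> P4) \<and>
        (P1 \<longrightarrow> min_weak_drazin_inverses f = (\<lambda>y. \<alpha> * y) ` min_weak_drazin_inverses a)"
proof -
  define x where "x = pseudo_core_inverse a"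
  define d where "d = drazin_inverse a"
  let ?T = "block_triangular f (a * x) s"
  have "is_pseudo_core_inverse a x"
    using assms(3) pseudo_core_inverse_eq_iff x_def by blast
  then have x: "x \<in> min_weak_drazin_inverses a" and sym: "star (a * x) = a * x"
    by (simp_all add: is_pseudo_core_inverse_iff)
  have d: "d \<in> min_weak_drazin_inverses a"
    unfolding d_def
    by (intro drazin_inverse_min_weak drazin_invertible_if_pseudo_core_invertible assms(3))
  have inv: "(1 + x * b) * \<alpha> = 1" "\<alpha> * (1 + x * b) = 1"
    using inverse_elem_cancel[OF assms(5)] unfolding \<alpha>_def x_def by simp_all
  have iff: "\<alpha> * y \<in> min_weak_drazin_inverses f \<and> drazin_index f \<le> s \<longleftrightarrow> ?T"
    if "y \<in> min_weak_drazin_inverses a" for y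
    unfolding f_def by (rule perturbed_min_weak_iff[OF x that inv \<open>s > 0\<close>])

  have P1: "(1 - a * x) * b * a * x = 0 \<and> (1 - a * x) * (a + b) ^ s * (1 - a * x) = 0 \<longleftrightarrow> ?T"
    using block_triangular_iff[OF x, of b s] by (simp add: f_def mult.assoc)

  have "star (f * (\<alpha> * x)) = f * (\<alpha> * x)" if ?T
    using perturbed_product[OF x x inv] that sym unfolding f_def by simp
  then have P2: "pseudo_core_invertible f \<and> pseudo_core_inverse f = \<alpha> * x \<and>
      drazin_index f \<le> s \<longleftrightarrow> ?T"
    using iff[OF x] pseudo_core_inverse_eq_iff is_pseudo_core_inverse_iff by blast

  have P3: "invertible_elem (1 + d * b) \<and>
      inverse_elem (1 + d * b) * d \<in> min_weak_drazin_inverses f \<and> drazin_index f \<le> s \<longleftrightarrow> ?T"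
    (is "?L \<longleftrightarrow> _")
  proof
    assume L: ?L
    then have "block_triangular f (a * d) s"
      using perturbed_min_weak_iff[OF d d inverse_elem_cancel \<open>s > 0\<close>] unfolding f_def by blast
    then show ?T
      using block_triangular_cong min_weak_idempotent_fixes(3) x d by blast
  next
    assume t: ?T
    note c = inverse_change_min_weak[OF x d inv t[unfolded f_def]]
    have "invertible_elem (1 + d * b)" unfolding invertible_elem_def using c by blast
    moreover have "inverse_elem (1 + d * b) * d = \<alpha> * d"
      by (simp only: inverse_elem_eqI[OF c(1,2)] c(3))
    ultimately show ?L using t iff[OF d] by simp
  qed

  have P4: "(\<forall>y \<in> min_weak_drazin_inverses a.
      \<alpha> * y \<in> min_weak_drazin_inverses f \<and> drazin_index f \<le> s) \<longleftrightarrow> ?T"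
    using iff x by blast

  have "?T \<Longrightarrow> min_weak_drazin_inverses f = (\<lambda>y. \<alpha> * y) ` min_weak_drazin_inverses a"
    unfolding f_def by (rule perturbed_min_weak_set[OF x inv _ \<open>s > 0\<close>])
  with P1 P2 P3 P4 show ?thesis
    unfolding Let_def x_def[symmetric] d_def[symmetric] by blast
qed

end
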